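(* Let $\approx_c$ be the congruence on the set of forms $\mathrm{Fm}_0$ generated by $\approx$ together with the idempotence law $ff\approx_c f$. Then $\mathrm{Fm}_0/{\approx_c}$ is isomorphic to $(\mathrm{HF};\,\emptyset,\{\cdot\},\cup)$, the algebra of hereditarily finite sets with singleton and union; under this isomorphism the composite operation $x\langle y\rangle$ (juxtaposition of $x$ with the enclosure of $y$) is set adjunction $x\cup\{y\}$.
   Context: $\mathrm{Fm}_0$ is the smallest set of (formal) expressions containing the empty expression $\epsilon$ and closed under enclosure $f\mapsto\langle f\rangle$ and juxtaposition $(f,g)\mapsto fg$. $\approx$ is the congruence on $\mathrm{Fm}_0$ (with respect to both operations) generated by $(fg)h\approx f(gh)$, $fg\approx gf$, $f\epsilon\approx f$. The congruence $\approx_c$ is likewise with respect to both operations. The quotient $\mathrm{Fm}_0/{\approx_c}$ is regarded as an algebra with constant the class of $\epsilon$, unary operation enclosure and binary operation juxtaposition, corresponding to $\emptyset$, $\{\cdot\}$ and $\cup$ respectively. $\mathrm{HF}$ is the set of hereditarily finite sets. *)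

theory Defs
  imports Main "HOL-Library.FSet"
begin

text \<open>Forms are formal expressions: juxtaposition is a free binary operation, and
  associativity holds only modulo the congruences below.\<close>

datatype form =
    Eps
  | Encl form
  | Juxt form form

inductive congruence_gen :: "(form \<Rightarrow> form \<Rightarrow> bool) \<Rightarrow> form \<Rightarrow> form \<Rightarrow> bool"
  for R :: "form \<Rightarrow> form \<Rightarrow> bool"
where
  base: "R f g \<Longrightarrow> congruence_gen R f g"
| refl: "congruence_gen R f f"
| sym: "congruence_gen R f g \<Longrightarrow> congruence_gen R g f"
| trans: "congruence_gen R f g \<Longrightarrow> congruence_gen R g h \<Longrightarrow> congruence_gen R f h"
| encl: "congruence_gen R f g \<Longrightarrow> congruence_gen R (Encl f) (Encl g)"
| juxt: "congruence_gen R f f' \<Longrightarrow> congruence_gen R g g' \<Longrightarrow>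
    congruence_gen R (Juxt f g) (Juxt f' g')"

inductive comm_monoid_law :: "form \<Rightarrow> form \<Rightarrow> bool" where
  assoc: "comm_monoid_law (Juxt (Juxt f g) h) (Juxt f (Juxt g h))"
| comm: "comm_monoid_law (Juxt f g) (Juxt g f)"
| unit: "comm_monoid_law (Juxt f Eps) f"

definition form_eq :: "form \<Rightarrow> form \<Rightarrow> bool" (infix "\<approx>" 50) where
  "form_eq = congruence_gen comm_monoid_law"

inductive form_eq_or_idem :: "form \<Rightarrow> form \<Rightarrow> bool" where
  eq: "f \<approx> g \<Longrightarrow> form_eq_or_idem f g"
| idem: "form_eq_or_idem (Juxt f f) f"

definition form_eqc :: "form \<Rightarrow> form \<Rightarrow> bool" (infix "\<approx>\<^sub>c" 50) where
  "form_eqc = congruence_gen form_eq_or_idem"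

lemma equivp_form_eqc: "equivp form_eqc"
  unfolding form_eqc_def
  by (intro equivpI reflpI sympI transpI)
    (blast intro: congruence_gen.refl congruence_gen.sym congruence_gen.trans)+

quotient_type form_c = form / form_eqc
  by (rule equivp_form_eqc)

lift_definition eps_c :: form_c is Eps .

lift_definition encl_c :: "form_c \<Rightarrow> form_c" is Encl
  unfolding form_eqc_def by (rule congruence_gen.encl)

lift_definition juxt_c :: "form_c \<Rightarrow> form_c \<Rightarrow> form_c" is Juxt
  unfolding form_eqc_def by (rule congruence_gen.juxt)

text \<open>A hereditarily finite set is a finite set of hereditarily finite sets. The datatype
  is the least solution of this, so membership is well-founded, and equality is
  extensional because it is equality of the underlying finite sets of elements.\<close>

datatype hf = HF (elts: "hf fset")

definition hf_empty :: hf where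
  "hf_empty = HF {||}"

definition hf_singleton :: "hf \<Rightarrow> hf" where
  "hf_singleton x = HF {|x|}"

definition hf_union :: "hf \<Rightarrow> hf \<Rightarrow> hf" where
  "hf_union x y = HF (elts x |\<union>| elts y)"

text \<open>Isomorphisms between algebras with a constant, a unary and a binary operation,
  both carriers being whole types.\<close>

definition algebra_iso ::
    "'a \<Rightarrow> ('a \<Rightarrow> 'a) \<Rightarrow> ('a \<Rightarrow> 'a \<Rightarrow> 'a) \<Rightarrow>
     'b \<Rightarrow> ('b \<Rightarrow> 'b) \<Rightarrow> ('b \<Rightarrow> 'b \<Rightarrow> 'b) \<Rightarrow> ('a \<Rightarrow> 'b) \<Rightarrow> bool" where
  "algebra_iso c u b c' u' b' \<phi> \<longleftrightarrow>
     bij \<phi> \<and> \<phi> c = c' \<and> (\<forall>x. \<phi> (u x) = u' (\<phi> x)) \<and> (\<forall>x y. \<phi> (b x y) = b' (\<phi> x) (\<phi> y))"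

end

theory Submission
  imports Defs
begin

text \<open>Evaluating a form as a hereditarily finite set respects \<open>\<approx>\<^sub>c\<close>. In the other direction,
  juxtaposition is a semilattice operation on the quotient, so by recursion every finite set
  can be sent to the join of the enclosures of the classes of its elements, independently of
  order and repetition. Both maps are homomorphisms and each generating operation is preserved,
  so they are mutually inverse by induction.\<close>

primrec eval :: "form \<Rightarrow> hf" where
  "eval Eps = hf_empty"
| "eval (Encl f) = hf_singleton (eval f)"
| "eval (Juxt f g) = hf_union (eval f) (eval g)"

lemma eval_form_eq: "f \<approx> g \<Longrightarrow> eval f = eval g"
  unfolding form_eq_def
proof (induction rule: congruence_gen.induct)
  case (base f g)
  then show ?case
    by cases (auto simp: hf_union_def hf_empty_def)
qed auto

lemma eval_form_eqc: "f \<approx>\<^sub>c g \<Longrightarrow> eval f = eval g"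
  unfolding form_eqc_def
proof (induction rule: congruence_gen.induct)
  case (base f g)
  then show ?case
    by cases (auto simp: hf_union_def eval_form_eq)
qed auto

lift_definition eval_c :: "form_c \<Rightarrow> hf" is eval
  by (rule eval_form_eqc)

lemma eval_c_simps:
  "eval_c eps_c = hf_empty"
  "eval_c (encl_c x) = hf_singleton (eval_c x)"
  "eval_c (juxt_c x y) = hf_union (eval_c x) (eval_c y)"
  by (transfer, simp)+

text \<open>The laws sit under two nested congruence closures, first that of \<open>form_eq\<close>
  and then that of \<open>form_eqc\<close>, so \<open>base\<close> is applied once for each.\<close>

lemma form_eqcI:
  "comm_monoid_law f g \<Longrightarrow> f \<approx>\<^sub>c g"
  unfolding form_eqc_def form_eq_def
  by (intro congruence_gen.base form_eq_or_idem.eq) (simp add: form_eq_def congruence_gen.base)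

lemma juxt_c_assoc: "juxt_c (juxt_c x y) z = juxt_c x (juxt_c y z)"
  by transfer (intro form_eqcI comm_monoid_law.assoc)

lemma juxt_c_commute: "juxt_c x y = juxt_c y x"
  by transfer (intro form_eqcI comm_monoid_law.comm)

lemma juxt_c_eps_right: "juxt_c x eps_c = x"
  by transfer (intro form_eqcI comm_monoid_law.unit)

lemma juxt_c_idem: "juxt_c x x = x"
  by transfer (simp add: form_eqc_def congruence_gen.base form_eq_or_idem.idem)

interpretation juxt_c: semilattice_neutr juxt_c eps_c
  by unfold_locales (fact juxt_c_assoc juxt_c_commute juxt_c_idem juxt_c_eps_right)+

text \<open>Every class has a representative form, so structural induction on forms descends to the
  quotient.\<close>

lemma form_c_induct [case_names eps encl juxt]:
  assumes "P eps_c"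
    and "\<And>x. P x \<Longrightarrow> P (encl_c x)"
    and "\<And>x y. P x \<Longrightarrow> P y \<Longrightarrow> P (juxt_c x y)"
  shows "P x"
proof -
  have "P (abs_form_c f)" for f
    by (induction f)
      (use assms in \<open>simp_all flip: eps_c.abs_eq encl_c.abs_eq juxt_c.abs_eq\<close>)
  then show ?thesis
    by (metis Quotient_form_c Quotient_abs_rep)
qed

interpretation encl_juxt: comp_fun_idem "\<lambda>x. juxt_c (encl_c x)"
  by unfold_locales (auto simp: fun_eq_iff juxt_c.left_commute)

definition join_encl :: "form_c fset \<Rightarrow> form_c" where
  "join_encl = ffold (\<lambda>x. juxt_c (encl_c x)) eps_c"

lemma join_encl_empty: "join_encl {||} = eps_c"
  by (simp add: join_encl_def)

lemma join_encl_finsert: "join_encl (finsert x A) = juxt_c (encl_c x) (join_encl A)"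
  by (simp add: join_encl_def encl_juxt.ffold_finsert_idem)

text \<open>Overlap of \<open>A\<close> and \<open>B\<close> is harmless: by idempotence,
  \<open>join_encl_finsert\<close> holds even when the inserted element is already present.\<close>

lemma join_encl_union: "join_encl (A |\<union>| B) = juxt_c (join_encl A) (join_encl B)"
  by (induction A) (simp_all add: join_encl_empty join_encl_finsert juxt_c.assoc)

lemma eval_c_join_encl: "eval_c (join_encl A) = HF (eval_c |`| A)"
  by (induction A)
    (simp_all add: join_encl_empty join_encl_finsert eval_c_simps
      hf_empty_def hf_singleton_def hf_union_def)

primrec form_of_hf :: "hf \<Rightarrow> form_c" where
  "form_of_hf (HF A) = join_encl (form_of_hf |`| A)"

lemma form_of_hf_simps:
  "form_of_hf hf_empty = eps_c"
  "form_of_hf (hf_singleton a) = encl_c (form_of_hf a)"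
  "form_of_hf (hf_union a b) = juxt_c (form_of_hf a) (form_of_hf b)"
  by (cases a; cases b; simp add: hf_empty_def hf_singleton_def hf_union_def
      join_encl_empty join_encl_finsert join_encl_union fimage_funion)+

lemma eval_c_form_of_hf: "eval_c (form_of_hf a) = a"
proof (induction a)
  case (HF A)
  \<comment> \<open>The induction hypothesis speaks only of members of \<open>A\<close>, which is
    all that congruence of the image requires.\<close>
  then have "(\<lambda>a. eval_c (form_of_hf a)) |`| A = id |`| A"
    by (intro fset.map_cong) simp_all
  then show ?case
    by (simp add: eval_c_join_encl fset.map_comp comp_def)
qed

text \<open>The composite is an endomorphism of an algebra generated by its constant, hence the
  identity.\<close>

lemma form_of_hf_eval_c: "form_of_hf (eval_c x) = x"
  by (induction x rule: form_c_induct) (simp_all add: eval_c_simps form_of_hf_simps)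

lemma bij_eval_c: "bij eval_c"
  by (rule o_bij[of form_of_hf]) (simp_all add: fun_eq_iff eval_c_form_of_hf form_of_hf_eval_c)

theorem theorem8p3:
  shows "\<exists>\<phi> :: form_c \<Rightarrow> hf.
    algebra_iso eps_c encl_c juxt_c hf_empty hf_singleton hf_union \<phi> \<and>
    (\<forall>x y. \<phi> (juxt_c x (encl_c y)) = hf_union (\<phi> x) (hf_singleton (\<phi> y)))"
  by (rule exI[of _ eval_c]) (simp add: algebra_iso_def bij_eval_c eval_c_simps)

end
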